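(* Let $0<q<1$. For any $\eta\in\mathbb{N}=\{0,1,2,\dots\}$ and any integers $m\ge n\ge1$, $$\det\big((\Delta^{j-i-1}w_m)(\eta+1)\big)_{1\le i,j\le n}=\frac1{Z_{m,n}}\sum_{x\in\{0,1,\dots,\eta+n-1\}^n}\Delta_n(x)^2\prod_{j=1}^n\binom{x_j+m-n}{x_j}q^{x_j},$$ where $Z_{m,n}=\sum_{x\in\mathbb{N}^n}\Delta_n(x)^2\prod_{j=1}^n\binom{x_j+m-n}{x_j}q^{x_j}$ is the normalization constant of the Meixner ensemble.
   Context: Functions: $H(x)=1$ for $x\ge0$ and $H(x)=0$ for $x<0$. For $m\ge1$ and $x\in\mathbb{Z}$, $w_m(x)=(1-q)^m\binom{x+m-1}{x}q^xH(x)$ (the $m$-fold convolution of $(1-q)q^xH(x)$ with itself). Difference operators: for $f:\mathbb{Z}\to\mathbb{C}$, $\Delta f(x)=f(x+1)-f(x)$, $\Delta^0f=f$, and $(\Delta^{-1}f)(x)=\sum_{y=-\infty}^{x-1}f(y)$ whenever the sum converges; $\Delta^k$ for $k>0$ and $\Delta^{-k}$ for $k>0$ denote the $k$-fold iterates of $\Delta$ and $\Delta^{-1}$ respectively. $\Delta_n(x)=\det(x_i^{j-1})_{1\le i,j\le n}$ (with subscript $n$ and vector argument) is the Vandermonde determinant. *)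

theory Defs
  imports "HOL-Analysis.Infinite_Sum" "HOL-Library.FuncSet" "Jordan_Normal_Form.Determinant"
begin

definition heaviside :: "int \<Rightarrow> real" where
  "heaviside x = (if x \<ge> 0 then 1 else 0)"

text \<open>The truncation by \<open>nat\<close> in the binomial coefficient is harmless for \<open>m \<ge> 1\<close>: it only
  has an effect when \<open>x < 0\<close>, and there the Heaviside factor vanishes.\<close>

definition weight :: "real \<Rightarrow> nat \<Rightarrow> int \<Rightarrow> complex" where
  "weight q m x = complex_of_real
     ((1 - q) ^ m * real (nat (x + int m - 1) choose nat x) * (q powi x) * heaviside x)"

definition fdiff :: "(int \<Rightarrow> complex) \<Rightarrow> int \<Rightarrow> complex" where
  "fdiff f x = f (x + 1) - f x"

text \<open>The sum of \<open>f y\<close> over \<open>y = x - 1, x - 2, \<dots>\<close>, reindexed by \<open>y = x - 1 - k\<close>. The value is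
  meaningful only where this series converges.\<close>

definition fsum :: "(int \<Rightarrow> complex) \<Rightarrow> int \<Rightarrow> complex" where
  "fsum f x = (\<Sum>k. f (x - 1 - int k))"

definition fdiff_pow :: "int \<Rightarrow> (int \<Rightarrow> complex) \<Rightarrow> int \<Rightarrow> complex" where
  "fdiff_pow k f = (if k \<ge> 0 then (fdiff ^^ nat k) f else (fsum ^^ nat (- k)) f)"

text \<open>Matrix and vector indices run over \<open>0, \<dots>, n - 1\<close>, so the entry \<open>x\<^sub>i\<^bsup>j-1\<^esup>\<close> of the
  one-based convention becomes \<open>x i ^ j\<close>. Points of \<open>A\<^sup>n\<close> are the functions in
  \<open>{..<n} \<rightarrow>\<^sub>E A\<close>.\<close>

definition vandermonde :: "nat \<Rightarrow> (nat \<Rightarrow> real) \<Rightarrow> real" where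
  "vandermonde n x = Determinant.det (Matrix.mat n n (\<lambda>(i, j). x i ^ j))"

definition meixner_density :: "real \<Rightarrow> nat \<Rightarrow> nat \<Rightarrow> (nat \<Rightarrow> nat) \<Rightarrow> real" where
  "meixner_density q m n x =
     (vandermonde n (\<lambda>i. real (x i)))\<^sup>2 * (\<Prod>j<n. real ((x j + m - n) choose x j) * q ^ x j)"

definition meixner_Z :: "real \<Rightarrow> nat \<Rightarrow> nat \<Rightarrow> real" where
  "meixner_Z q m n = (\<Sum>\<^sub>\<infinity>x\<in>{..<n} \<rightarrow>\<^sub>E UNIV. meixner_density q m n x)"

end

theory Submission
  imports Defs "HOL-Analysis.Infinite_Set_Sum" "HOL-Analysis.Generalised_Binomial_Theorem"
begin

text \<open>
  Write \<open>w\<close> for the weight, \<open>D j = \<Delta>\<^sup>j w\<close>, \<open>L = \<eta> + n - 1\<close> and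
  \<open>W y = ((y + m - n) choose y) q\<^sup>y\<close>, the one-particle weight of the Meixner ensemble. The idea is
  that the determinant of the theorem and, up to a constant factor, the normalization \<open>Z\<close> are the
  instances \<open>S = {0..L}\<close> and \<open>S = \<nat>\<close> of one determinant
  \<open>G S = det (\<Sum>y\<in>S. ((L - y) gchoose i) D j (y - n + 1))\<close>.

  Iterated summation is convolution with a binomial coefficient, and \<open>\<Delta>\<^sup>-\<^sup>1\<close> undoes \<open>\<Delta>\<close> on functions
  vanishing near \<open>-\<infinity>\<close>. Hence the \<open>(i, j)\<close> entry of the theorem is the \<open>(i + 1)\<close>-fold sum
  of \<open>D j\<close>, which makes the left-hand side equal to \<open>G {0..L}\<close>
  (\<open>fdiff_pow_eq_gbinomial_sum\<close>).

  For \<open>j < n\<close> the shifted function \<open>D j (y - n + 1)\<close> is \<open>W y\<close> times a polynomial in \<open>y\<close> of degree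
  less than \<open>n\<close> (\<open>funpow_fdiff_weight_eq_poly\<close>), and \<open>(L - y) gchoose i\<close> is a polynomial in \<open>y\<close> of
  degree \<open>i\<close>. Multilinearity and the Andreief identity therefore give
  \<open>G S = C (\<Sum>x\<in>S\<^sup>n. \<Delta>\<^sub>n(x)\<^sup>2 \<Prod>j. W (x j))\<close>, where \<open>C\<close> is built from the coefficients of these
  polynomials and is the same for every \<open>S\<close> (\<open>det_poly_sums\<close>).

  The constant is found without computing it: for \<open>S = \<nat>\<close>, summation by parts lowers \<open>i\<close> and \<open>j\<close>
  together until one of them is zero, so the matrix is lower triangular, and its diagonal entries
  are the total mass \<open>\<Sum>y. w y = 1\<close> (\<open>gbinomial_funpow_fdiff_weight_sum\<close>). Thus
  \<open>C Z = G \<nat> = 1\<close>.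
\<close>

section \<open>The Andreief identity over infinite sets\<close>

(* Both summability constants use this notation; below it stands for summability of the norms. *)
no_notation Infinite_Set_Sum.abs_summable_on (infix "abs'_summable'_on" 50)

lemma has_sum_finite_sum:
  fixes f :: "'i \<Rightarrow> 'a \<Rightarrow> 'b::topological_comm_monoid_add"
  assumes "finite I" "\<And>i. i \<in> I \<Longrightarrow> (f i has_sum s i) A"
  shows "((\<lambda>x. \<Sum>i\<in>I. f i x) has_sum (\<Sum>i\<in>I. s i)) A"
  using assms by (induction rule: finite_induct) (auto intro: has_sum_add)

lemma prod_summable_PiE:
  fixes f :: "'i \<Rightarrow> 'a::countable \<Rightarrow> real"
  assumes "finite A" "\<And>i. i \<in> A \<Longrightarrow> f i abs_summable_on B"
  shows "(\<lambda>x. \<Prod>i\<in>A. f i (x i)) summable_on (A \<rightarrow>\<^sub>E B)"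
proof -
  have "Infinite_Set_Sum.abs_summable_on (\<lambda>x. \<Prod>i\<in>A. f i (x i)) (A \<rightarrow>\<^sub>E B)"
    by (rule abs_summable_on_prod_PiE)
      (use assms in \<open>auto intro!: abs_summable_equivalent[THEN iffD1]\<close>)
  then show ?thesis
    by (rule abs_summable_summable[OF abs_summable_equivalent[THEN iffD2]])
qed

text \<open>Both determinants are expanded over permutations \<open>\<sigma>\<close> and \<open>\<tau>\<close>. The sum over \<open>x\<close> of each product then
  factors into one-variable sums, and for fixed \<open>\<sigma>\<close> the sum over \<open>\<tau>\<close> is a determinant with rows
  permuted by \<open>\<sigma>\<close>, so each of the \<open>n!\<close> permutations \<open>\<sigma>\<close> contributes equally.\<close>

lemma andreief:
  fixes f g :: "nat \<Rightarrow> 'a::countable \<Rightarrow> real"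
  assumes "\<And>i j. i < n \<Longrightarrow> j < n \<Longrightarrow> (\<lambda>y. f i y * g j y) abs_summable_on S"
  shows "(\<Sum>\<^sub>\<infinity>x\<in>{..<n} \<rightarrow>\<^sub>E S. Determinant.det (Matrix.mat n n (\<lambda>(i, j). f j (x i))) *
            Determinant.det (Matrix.mat n n (\<lambda>(i, j). g j (x i)))) =
         fact n * Determinant.det (Matrix.mat n n (\<lambda>(i, j). \<Sum>\<^sub>\<infinity>y\<in>S. f i y * g j y))"
proof -
  let ?P = "{p. p permutes {0..<n}}"
  let ?h = "\<lambda>i j. \<Sum>\<^sub>\<infinity>y\<in>S. f i y * g j y"
  let ?t = "\<lambda>\<sigma> \<tau> x. \<Prod>i\<in>{..<n}. f (\<sigma> i) (x i) * g (\<tau> i) (x i)"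
  have fin: "finite ?P" by (simp add: finite_permutations)
  have lt: "p i < n" if "p \<in> ?P" "i < n" for p i
    using that permutes_in_image[of p "{0..<n}" i] by auto
  have expand: "Determinant.det (Matrix.mat n n (\<lambda>(i, j). f j (x i))) *
      Determinant.det (Matrix.mat n n (\<lambda>(i, j). g j (x i)))
      = (\<Sum>\<sigma>\<in>?P. \<Sum>\<tau>\<in>?P. (signof \<sigma> * signof \<tau>) * ?t \<sigma> \<tau> x)" for x
  proof -
    have leib: "Determinant.det (Matrix.mat n n (\<lambda>(i, j). k j (x i)))
        = (\<Sum>p\<in>?P. signof p * (\<Prod>i\<in>{..<n}. k (p i) (x i)))" for k :: "nat \<Rightarrow> 'a \<Rightarrow> real"
      by (subst det_def'[where n = n]) (auto simp: lt lessThan_atLeast0 intro!: sum.cong prod.cong)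
    show ?thesis
      unfolding leib sum_product
      by (intro sum.cong refl) (simp add: prod.distrib mult_ac)
  qed
  have summ: "?t \<sigma> \<tau> summable_on ({..<n} \<rightarrow>\<^sub>E S)" if "\<sigma> \<in> ?P" "\<tau> \<in> ?P" for \<sigma> \<tau>
    by (rule prod_summable_PiE) (use that assms lt in auto)
  have val: "(\<Sum>\<^sub>\<infinity>x\<in>{..<n} \<rightarrow>\<^sub>E S. ?t \<sigma> \<tau> x) = (\<Prod>i\<in>{..<n}. ?h (\<sigma> i) (\<tau> i))"
    if "\<sigma> \<in> ?P" "\<tau> \<in> ?P" for \<sigma> \<tau>
    by (rule infsum_prod_PiE_abs) (use that assms lt in auto)
  have row: "(\<Sum>\<tau>\<in>?P. (signof \<sigma> * signof \<tau>) * (\<Prod>i\<in>{..<n}. ?h (\<sigma> i) (\<tau> i)))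
      = Determinant.det (Matrix.mat n n (\<lambda>(i, j). ?h i j))" if "\<sigma> \<in> ?P" for \<sigma>
  proof -
    let ?H = "Matrix.mat n n (\<lambda>(i, j). ?h i j)"
    have "(\<Sum>\<tau>\<in>?P. (signof \<sigma> * signof \<tau>) * (\<Prod>i\<in>{..<n}. ?h (\<sigma> i) (\<tau> i)))
        = signof \<sigma> * Determinant.det (Matrix.mat n n (\<lambda>(i, j). ?H $$ (\<sigma> i, j)))"
      by (subst det_def'[where n = n])
        (auto simp: sum_distrib_left mult.assoc lt[OF that] lt lessThan_atLeast0 intro!: sum.cong prod.cong)
    also have "\<dots> = signof \<sigma> * (signof \<sigma> * Determinant.det ?H)"
      by (subst det_permute_rows) (use that in auto)
    also have "\<dots> = Determinant.det ?H"
      by (auto simp: sign_def)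
    finally show ?thesis .
  qed
  have "(\<Sum>\<^sub>\<infinity>x\<in>{..<n} \<rightarrow>\<^sub>E S. Determinant.det (Matrix.mat n n (\<lambda>(i, j). f j (x i))) *
            Determinant.det (Matrix.mat n n (\<lambda>(i, j). g j (x i))))
      = (\<Sum>\<sigma>\<in>?P. \<Sum>\<tau>\<in>?P. (signof \<sigma> * signof \<tau>) * (\<Sum>\<^sub>\<infinity>x\<in>{..<n} \<rightarrow>\<^sub>E S. ?t \<sigma> \<tau> x))"
    unfolding expand
    by (intro infsumI has_sum_finite_sum has_sum_cmult_right has_sum_infsum summ fin)
  also have "\<dots> = (\<Sum>\<sigma>\<in>?P. Determinant.det (Matrix.mat n n (\<lambda>(i, j). ?h i j)))"
    by (intro sum.cong refl) (simp add: val flip: row)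
  also have "\<dots> = fact n * Determinant.det (Matrix.mat n n (\<lambda>(i, j). ?h i j))"
    by (simp add: card_permutations)
  finally show ?thesis .
qed

section \<open>Negative binomial weights\<close>

lemma negative_binomial_sums:
  fixes q :: real
  assumes "0 \<le> q" "q < 1"
  shows "(\<lambda>y. real ((y + u) choose y) * q ^ y) sums (1 / (1 - q) ^ Suc u)"
proof -
  have "(\<lambda>y. ((- real (Suc u)) gchoose y) * (- q) ^ y) sums (1 + (- q)) powr (- real (Suc u))"
    by (rule gen_binomial_real) (use assms in auto)
  moreover have "((- real (Suc u)) gchoose y) * (- q) ^ y = real ((y + u) choose y) * q ^ y" for y
  proof -
    have "((- real (Suc u)) gchoose y) = (-1) ^ y * (real (y + u) gchoose y)"
      by (subst gbinomial_minus) (simp add: algebra_simps)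
    then show ?thesis
      by (simp add: binomial_gbinomial power_minus[of q] mult.assoc mult.left_commute)
  qed
  moreover have "(1 + (- q)) powr (- real (Suc u)) = 1 / (1 - q) ^ Suc u"
    using assms by (simp add: powr_minus powr_realpow divide_inverse del: of_nat_Suc power_Suc)
  ultimately show ?thesis by simp
qed

lemma power_mult_fact_le: "y ^ k * fact (y + u) \<le> (fact (y + u + k) :: nat)"
proof (induction k)
  case (Suc k)
  have "y ^ Suc k * fact (y + u) \<le> Suc (y + u + k) * fact (y + u + k)"
    using mult_mono[of y "Suc (y+u+k)", OF _ Suc] by (simp add: mult.assoc)
  then show ?case by simp
qed simp

text \<open>The moment series is dominated by the negative binomial series with the larger parameter \<open>u + k\<close>,
  because \<open>y\<^sup>k (y + u)! \<le> (y + u + k)!\<close>.\<close>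

lemma moments_summable:
  fixes q :: real
  assumes "0 \<le> q" "q < 1"
  shows "(\<lambda>y. real y ^ k * (real ((y + u) choose y) * q ^ y)) abs_summable_on S"
proof -
  have le: "real y ^ k * (real ((y + u) choose y) * q ^ y)
      \<le> (fact (u + k) / fact u) * (real ((y + (u + k)) choose y) * q ^ y)" for y
  proof -
    have "real y ^ k * fact (y + u) \<le> fact (y + u + k)"
      using power_mult_fact_le[of y k u] by (metis of_nat_fact of_nat_le_iff of_nat_mult of_nat_power)
    then have "real y ^ k * real ((y + u) choose y) 
        \<le> (fact (u + k) / fact u) * real ((y + (u + k)) choose y)"
      by (simp add: binomial_fact field_simps)
    from mult_right_mono[OF this, of "q ^ y"] show ?thesis
      using assms by (simp add: mult.assoc)
  qed
  have "summable (\<lambda>y. (fact (u + k) / fact u) * (real ((y + (u + k)) choose y) * q ^ y))"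
    by (intro summable_mult sums_summable[OF negative_binomial_sums] assms)
  then have "summable (\<lambda>y. norm (real y ^ k * (real ((y + u) choose y) * q ^ y)))"
    by (rule summable_comparison_test'[where N = 0]) (use le assms in auto)
  then have "(\<lambda>y. real y ^ k * (real ((y + u) choose y) * q ^ y)) abs_summable_on UNIV"
    using norm_summable_imp_summable_on[of "\<lambda>y. norm (real y ^ k * (real ((y + u) choose y) * q ^ y))"] by simp
  then show ?thesis
    by (rule summable_on_subset_banach) auto
qed


section \<open>Iterated differences and sums\<close>

lemma funpow_fdiff_eq_zero:
  assumes "\<And>y. y < s \<Longrightarrow> f y = 0" and "x + int j < s"
  shows "(fdiff ^^ j) f x = 0"
  using assms(2) by (induction j arbitrary: x) (auto simp: fdiff_def assms(1))

text \<open>The series telescopes, and its far end vanishes by the support condition.\<close>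

lemma fsum_fdiff:
  assumes "\<And>y. y < s \<Longrightarrow> f y = 0"
  shows "fsum (fdiff f) = f"
proof
  fix x
  let ?h = "\<lambda>k. f (x - int k)"
  have "eventually (\<lambda>k. ?h k = 0) sequentially"
    using eventually_ge_at_top[of "nat (x - s + 1)"] by eventually_elim (auto intro: assms)
  then have "?h \<longlonglongrightarrow> 0" by (rule tendsto_eventually)
  from telescope_sums'[OF this] have "(\<lambda>k. ?h k - ?h (Suc k)) sums f x" by simp
  moreover have "fdiff f (x - 1 - int k) = ?h k - ?h (Suc k)" for k
    by (simp add: fdiff_def algebra_simps)
  ultimately show "fsum (fdiff f) x = f x" by (simp add: fsum_def sums_iff)
qed

lemma funpow_fsum_funpow_fdiff:
  assumes "\<And>y. y < s \<Longrightarrow> f y = 0"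
  shows "(fsum ^^ k) ((fdiff ^^ k) f) = f"
proof (induction k)
  case (Suc k)
  have "(fdiff ^^ k) f y = 0" if "y < s - int k" for y
    by (rule funpow_fdiff_eq_zero[of s]) (use assms that in auto)
  then have "fsum (fdiff ((fdiff ^^ k) f)) = (fdiff ^^ k) f"
    by (rule fsum_fdiff)
  then show ?case using Suc by (simp add: funpow_swap1[of fsum])
qed simp

text \<open>Whatever the sign of the exponent, the operator can be written as \<open>i + 1\<close> summations after \<open>j\<close>
  differences, because the surplus of either kind cancels. In this form the row index and the column index
  act separately.\<close>

lemma fdiff_pow_eq_funpow:
  assumes "\<And>y. y < s \<Longrightarrow> f y = 0"
  shows "fdiff_pow (int j - int i - 1) f = (fsum ^^ Suc i) ((fdiff ^^ j) f)"
proof (cases "Suc i \<le> j")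
  case True
  then obtain d where d: "j = Suc i + d" using le_Suc_ex by blast
  have "(fdiff ^^ d) f y = 0" if "y < s - int d" for y
    by (rule funpow_fdiff_eq_zero[of s]) (use assms that in auto)
  then have "(fsum ^^ Suc i) ((fdiff ^^ Suc i) ((fdiff ^^ d) f)) = (fdiff ^^ d) f"
    by (rule funpow_fsum_funpow_fdiff)
  then have "(fsum ^^ Suc i) ((fdiff ^^ j) f) = (fdiff ^^ d) f"
    by (simp only: d funpow_add o_apply)
  then show ?thesis by (simp add: fdiff_pow_def d)
next
  case False
  then obtain d where d: "Suc i = Suc d + j"
    by (metis add.commute add_Suc_right le_Suc_ex not_less_eq_eq)
  have "(fsum ^^ Suc i) ((fdiff ^^ j) f) = (fsum ^^ Suc d) f"
    unfolding d funpow_add o_apply by (subst funpow_fsum_funpow_fdiff[OF assms]) auto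
  moreover have "nat (- (int j - int i - 1)) = Suc d" "\<not> 0 \<le> int j - int i - 1"
    using d by simp_all
  ultimately show ?thesis by (simp only: fdiff_pow_def if_False)
qed

text \<open>By Pascal's rule the binomial convolution with \<open>k choose Suc i\<close> has the one with \<open>k choose i\<close> as its
  difference. Since summation undoes differences, each further summation raises \<open>i\<close> by one.\<close>

lemma funpow_fsum_eq:
  assumes "\<And>y. y < s \<Longrightarrow> f y = 0"
  shows "(fsum ^^ Suc i) f = (\<lambda>x. \<Sum>k. of_nat (k choose i) * f (x - 1 - int k))"
proof (induction i)
  case 0
  show ?case by (auto simp: fsum_def)
next
  case (Suc i)
  let ?U = "\<lambda>i x. \<Sum>k. of_nat (k choose i) * f (x - 1 - int k)"
  have summ: "summable (\<lambda>k. c k * f (x - int k))" for c :: "nat \<Rightarrow> complex" and x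
    by (rule summable_finite[of "{..nat (x - s)}"]) (auto intro!: assms)
  have summ1: "summable (\<lambda>k. c k * f (x - 1 - int k))" for c :: "nat \<Rightarrow> complex" and x
    using summ[of c "x - 1"] by (simp add: algebra_simps)
  have "fdiff (?U (Suc i)) x = ?U i x" for x
  proof -
    have "?U (Suc i) (x + 1) = (\<Sum>k. of_nat (k choose Suc i) * f (x - int k))"
      by simp
    (* The term k = 0 vanishes because 0 choose Suc i = 0. *)
    also have "\<dots> = (\<Sum>k. of_nat (Suc k choose Suc i) * f (x - int (Suc k)))"
      by (subst suminf_split_head) (use summ in auto)
    also have "\<dots> = (\<Sum>k. of_nat (k choose i) * f (x - 1 - int k) + of_nat (k choose Suc i) * f (x - 1 - int k))"
      by (simp add: algebra_simps)
    also have "\<dots> = ?U i x + ?U (Suc i) x"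
      by (intro suminf_add[symmetric] summ1)
    finally show ?thesis by (simp add: fdiff_def)
  qed
  then have "fdiff (?U (Suc i)) = ?U i" by (rule ext)
  moreover have "fsum (fdiff (?U (Suc i))) = ?U (Suc i)"
    by (rule fsum_fdiff[of s]) (auto simp: assms)
  ultimately show ?case using Suc by simp
qed

text \<open>The summation index is reflected and shifted so that the support of \<open>(fdiff ^^ j) f\<close>, which starts no
  earlier than \<open>1 - n\<close> for \<open>j < n\<close>, starts at \<open>y = 0\<close>. The binomial coefficient is stated as a
  generalized one so that it is visibly a polynomial in \<open>y\<close>.\<close>

lemma fdiff_pow_eq_gbinomial_sum:
  assumes "\<And>y. y < 0 \<Longrightarrow> f y = 0"
  assumes n: "j < n"
  shows "fdiff_pow (int j - int i - 1) f (int \<eta> + 1) =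
    (\<Sum>y\<in>{0..\<eta> + n - 1}. ((of_nat (\<eta> + n - 1) - of_nat y) gchoose i) * (fdiff ^^ j) f (int y - int n + 1))"
proof -
  define L where "L = \<eta> + n - 1"
  have L: "int L = int \<eta> + int n - 1" using n by (simp add: L_def)
  have z: "(fdiff ^^ j) f y = 0" if "y < - int j" for y
    by (rule funpow_fdiff_eq_zero[of 0]) (use assms that in auto)
  have "fdiff_pow (int j - int i - 1) f (int \<eta> + 1)
      = (\<Sum>k. of_nat (k choose i) * (fdiff ^^ j) f (int \<eta> - int k))"
    by (subst fdiff_pow_eq_funpow[OF assms(1)], assumption,
        subst funpow_fsum_eq[OF z], assumption) simp
  also have "\<dots> = (\<Sum>k\<in>{0..L}. of_nat (k choose i) * (fdiff ^^ j) f (int \<eta> - int k))"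
    by (rule suminf_finite) (use L n in \<open>auto intro!: z\<close>)
  also have "\<dots> = (\<Sum>y\<in>{0..L}. ((of_nat L - of_nat y) gchoose i) * (fdiff ^^ j) f (int y - int n + 1))"
    by (rule sum.reindex_bij_witness[of _ "\<lambda>y. L - y" "\<lambda>k. L - k"])
      (use L in \<open>auto simp: binomial_gbinomial of_nat_diff algebra_simps\<close>)
  finally show ?thesis by (simp add: L_def)
qed



section \<open>Determinants of sums of polynomials against a weight\<close>

lemma vandermonde_weighted_det:
  fixes w :: "nat \<Rightarrow> real"
  shows "Determinant.det (Matrix.mat n n (\<lambda>(i, j). w (x i) * real (x i) ^ j))
    = (\<Prod>i<n. w (x i)) * vandermonde n (\<lambda>i. real (x i))"
proof -
  have lt: "p i < n" if "p permutes {0..<n}" "i < n" for p i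
    using that permutes_in_image[of p "{0..<n}" i] by auto
  have "Determinant.det (Matrix.mat n n (\<lambda>(i, j). w (x i) * real (x i) ^ j))
    = (\<Sum>p | p permutes {0..<n}. (\<Prod>i<n. w (x i)) * (signof p * (\<Prod>i = 0..<n. real (x i) ^ p i)))"
    by (subst det_def'[where n = n]) (auto simp: lt prod.distrib lessThan_atLeast0 intro!: sum.cong)
  also have "\<dots> = (\<Prod>i<n. w (x i)) * vandermonde n (\<lambda>i. real (x i))"
    unfolding vandermonde_def
    by (subst det_def'[where n = n]) (auto simp: sum_distrib_left lt intro!: sum.cong)
  finally show ?thesis .
qed

lemma vandermonde_sum_eq_hankel_det:
  fixes w :: "nat \<Rightarrow> real"
  assumes "\<And>k. (\<lambda>y. real y ^ k * w y) abs_summable_on S"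
  shows "(\<Sum>\<^sub>\<infinity>x\<in>{..<n} \<rightarrow>\<^sub>E S. (vandermonde n (\<lambda>i. real (x i)))\<^sup>2 * (\<Prod>j<n. w (x j))) =
    fact n * Determinant.det (Matrix.mat n n (\<lambda>(k, l). \<Sum>\<^sub>\<infinity>y\<in>S. real y ^ (k + l) * w y))"
proof -
  have "(\<Sum>\<^sub>\<infinity>x\<in>{..<n} \<rightarrow>\<^sub>E S. (vandermonde n (\<lambda>i. real (x i)))\<^sup>2 * (\<Prod>j<n. w (x j)))
    = (\<Sum>\<^sub>\<infinity>x\<in>{..<n} \<rightarrow>\<^sub>E S. Determinant.det (Matrix.mat n n (\<lambda>(i, j). real (x i) ^ j)) *
            Determinant.det (Matrix.mat n n (\<lambda>(i, j). w (x i) * real (x i) ^ j)))"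
    unfolding vandermonde_weighted_det
    by (simp add: vandermonde_def power2_eq_square ac_simps)
  also have "\<dots> = fact n * Determinant.det (Matrix.mat n n (\<lambda>(k, l). \<Sum>\<^sub>\<infinity>y\<in>S. real y ^ k * (w y * real y ^ l)))"
  proof (rule andreief)
    fix i j
    show "(\<lambda>y. real y ^ i * (w y * real y ^ j)) abs_summable_on S"
      using assms[of "i + j"] by (simp add: power_add ac_simps)
  qed
  also have "(\<lambda>k l. \<Sum>\<^sub>\<infinity>y\<in>S. real y ^ k * (w y * real y ^ l)) = (\<lambda>k l. \<Sum>\<^sub>\<infinity>y\<in>S. real y ^ (k + l) * w y)"
    by (simp add: power_add ac_simps)
  finally show ?thesis .
qed

lemma poly_eq_sum_lessThan:
  fixes p :: "'a::comm_semiring_1 poly"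
  assumes "degree p < n"
  shows "poly p x = (\<Sum>k<n. coeff p k * x ^ k)"
  unfolding poly_altdef
  by (rule sum.mono_neutral_left) (use assms in \<open>auto simp: coeff_eq_0\<close>)

lemma has_sum_poly_moments:
  fixes w :: "nat \<Rightarrow> real" and a p :: "complex poly"
  assumes "\<And>k. (\<lambda>y. real y ^ k * w y) abs_summable_on S"
    and "degree a < n" "degree p < d"
  shows "((\<lambda>y. poly a (of_nat y) * (of_real (w y) * poly p (of_nat y))) has_sum
    (\<Sum>k<n. \<Sum>l<d. coeff a k * (of_real (\<Sum>\<^sub>\<infinity>y\<in>S. real y ^ (k + l) * w y) * coeff p l))) S"
proof -
  have "((\<lambda>y. real y ^ k * w y) has_sum (\<Sum>\<^sub>\<infinity>y\<in>S. real y ^ k * w y)) S" for k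
    using abs_summable_summable[OF assms(1)[of k]] by (rule has_sum_infsum)
  then have mom: "((\<lambda>y. complex_of_real (real y ^ k * w y)) has_sum of_real (\<Sum>\<^sub>\<infinity>y\<in>S. real y ^ k * w y)) S" for k
    by (rule has_sum_of_real)
  have "((\<lambda>y. \<Sum>k<n. \<Sum>l<d. coeff a k * (of_real (real y ^ (k + l) * w y) * coeff p l)) has_sum
    (\<Sum>k<n. \<Sum>l<d. coeff a k * (of_real (\<Sum>\<^sub>\<infinity>y\<in>S. real y ^ (k + l) * w y) * coeff p l))) S"
    by (intro has_sum_finite_sum has_sum_cmult_right has_sum_cmult_left mom finite_lessThan)
  moreover have "(\<Sum>k<n. \<Sum>l<d. coeff a k * (of_real (real y ^ (k + l) * w y) * coeff p l))
     = poly a (of_nat y) * (of_real (w y) * poly p (of_nat y))" for y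
  proof -
    have "of_real (w y) * poly p (of_nat y) = (\<Sum>l<d. of_real (w y) * (coeff p l * of_nat y ^ l))"
      unfolding poly_eq_sum_lessThan[OF assms(3)] by (rule sum_distrib_left)
    then show ?thesis
      unfolding poly_eq_sum_lessThan[OF assms(2)]
      by (simp only: sum_product) (intro sum.cong refl, simp add: power_add mult_ac)
  qed
  ultimately show ?thesis by simp
qed

text \<open>The matrix of sums factors as coefficients of \<open>a\<close>, Hankel matrix of moments, coefficients of \<open>p\<close>. Only the
  middle factor involves \<open>S\<close>, and the Andreief identity evaluates it. This lets two choices of
  \<open>S\<close> be compared without evaluating either coefficient determinant.\<close>

lemma det_poly_sums:
  fixes w :: "nat \<Rightarrow> real" and a p :: "nat \<Rightarrow> complex poly"
  assumes mom: "\<And>k. (\<lambda>y. real y ^ k * w y) abs_summable_on S"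
    and deg: "\<And>i. i < n \<Longrightarrow> degree (a i) < n" "\<And>j. j < n \<Longrightarrow> degree (p j) < n"
  shows "Determinant.det (Matrix.mat n n (\<lambda>(i, j).
      \<Sum>\<^sub>\<infinity>y\<in>S. poly (a i) (of_nat y) * (of_real (w y) * poly (p j) (of_nat y)))) =
    Determinant.det (Matrix.mat n n (\<lambda>(i, k). coeff (a i) k)) *
    Determinant.det (Matrix.mat n n (\<lambda>(l, j). coeff (p j) l)) / fact n *
    of_real (\<Sum>\<^sub>\<infinity>x\<in>{..<n} \<rightarrow>\<^sub>E S. (vandermonde n (\<lambda>i. real (x i)))\<^sup>2 * (\<Prod>j<n. w (x j)))"
proof -
  let ?A = "Matrix.mat n n (\<lambda>(i, k). coeff (a i) k)"
  let ?P = "Matrix.mat n n (\<lambda>(l, j). coeff (p j) l)"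
  let ?H = "Matrix.mat n n (\<lambda>(k, l). \<Sum>\<^sub>\<infinity>y\<in>S. real y ^ (k + l) * w y)"
  let ?C = "map_mat complex_of_real ?H"
  have "Matrix.mat n n (\<lambda>(i, j). \<Sum>\<^sub>\<infinity>y\<in>S. poly (a i) (of_nat y) * (of_real (w y) * poly (p j) (of_nat y)))
      = ?A * (?C * ?P)"
    by (rule eq_matI)
      (auto simp: scalar_prod_def infsumI[OF has_sum_poly_moments[OF mom deg]] lessThan_atLeast0
        sum_distrib_left intro!: sum.cong)
  moreover have "Determinant.det (?A * (?C * ?P)) = Determinant.det ?A * (Determinant.det ?C * Determinant.det ?P)"
    by (simp add: det_mult[where n = n] mult_carrier_mat[where n = n])
  moreover have "Determinant.det ?C = of_real (Determinant.det ?H)"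
    by (rule of_real_hom.hom_det)
  ultimately show ?thesis
    by (simp add: vandermonde_sum_eq_hankel_det[OF mom])
qed

section \<open>Differences of the weight as polynomials\<close>

lemma fact_eq_falling_prod:
  "c \<le> y \<Longrightarrow> fact y = (fact (y - c) * (\<Prod>i<c. of_nat y - of_nat i) :: 'a::{comm_ring_1, semiring_char_0})"
proof (induction c)
  case (Suc c)
  then have "(fact (y - c) :: 'a) = of_nat (y - c) * fact (y - Suc c)"
    by (metis Suc_diff_Suc Suc_le_lessD fact_Suc)
  then show ?case using Suc by (simp add: of_nat_diff)
qed simp

lemma fact_eq_rising_prod:
  "fact (N + s) = (fact N * (\<Prod>i<s. of_nat N + 1 + of_nat i) :: 'a::{comm_semiring_1, semiring_char_0})"
  by (induction s) (auto simp: algebra_simps)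

lemma weight_eq_zero: "x < 0 \<Longrightarrow> weight q m x = 0"
  by (simp add: weight_def heaviside_def)

text \<open>With \<open>c = n - 1 - s\<close> and \<open>u = m - n\<close>, the argument of the weight is \<open>y - c\<close> and
  \<open>(y + u + s choose (y - c))\<close> is, up to a constant, \<open>(y + u) choose y\<close> times
  \<open>y (y - 1) \<dots> (y - c + 1)\<close> times \<open>(y + u + 1) \<dots> (y + u + s)\<close>, of total degree \<open>c + s = n - 1\<close>.
  The falling factors vanish for \<open>y < c\<close>, exactly where the Heaviside factor does.\<close>

lemma weight_shift_eq_poly:
  assumes q: "q \<noteq> 0" and nm: "n \<le> m" and s: "s < n"
  shows "\<exists>p. degree p < n \<and> (\<forall>y. weight q m (int y - int n + 1 + int s) =
     of_real (real ((y + (m - n)) choose y) * q ^ y) * poly p (of_nat y))"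
proof -
  define c where "c = n - 1 - s"
  define u where "u = m - n"
  define K where "K = complex_of_real ((1 - q) ^ m) * fact u / (of_real q ^ c * fact (m - 1))"
  define p where "p = Polynomial.smult K ((\<Prod>i<c. [:- of_nat i, 1:]) * (\<Prod>i<s. [:of_nat u + 1 + of_nat i, 1:]))"
  have m: "m - 1 = u + c + s" using nm s by (simp add: u_def c_def)
  have "degree (\<Prod>i<c. [:- of_nat i, 1 :: complex:]) \<le> c"
    by (rule order.trans[OF degree_prod_sum_le]) auto
  moreover have "degree (\<Prod>i<s. [:of_nat u + 1 + of_nat i, 1 :: complex:]) \<le> s"
    by (rule order.trans[OF degree_prod_sum_le]) auto
  ultimately have "degree p \<le> c + s"
    unfolding p_def by (intro order.trans[OF degree_smult_le] order.trans[OF degree_mult_le] add_mono)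
  then have deg: "degree p < n" using s by (simp add: c_def)
  have "weight q m (int y - int n + 1 + int s) = of_real (real ((y + u) choose y) * q ^ y) * poly p (of_nat y)" for y
  proof (cases "c \<le> y")
    case False
    then have "int y - int n + 1 + int s < 0" using s by (simp add: c_def)
    moreover have "(\<Prod>i<c. (of_nat y - of_nat i :: complex)) = 0"
      using False by (intro prod_zero) auto
    ultimately show ?thesis by (simp add: weight_eq_zero p_def poly_prod)
  next
    case True
    have x: "int y - int n + 1 + int s = int (y - c)" using s True by (simp add: c_def)
    have "nat (int (y - c) + int m - 1) = y - c + (m - 1)" using nm s by simp
    moreover have "y - c + (m - 1) = y + u + s" using m True by simp
    ultimately have top: "nat (int (y - c) + int m - 1) = y + u + s" by simp
    have bin: "of_nat ((y + u + s) choose (y - c)) = (fact (y + u + s) / (fact (y - c) * fact (m - 1)) :: complex)"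
      using m True by (subst binomial_fact) (auto simp: ac_simps)
    have falling_nz: "(\<Prod>i<c. (of_nat y - of_nat i :: complex)) \<noteq> 0"
      using True by auto
    have "of_nat ((y + u + s) choose (y - c))
        = of_nat ((y + u) choose y) * (fact u / fact (m - 1)) *
          ((\<Prod>i<c. of_nat y - of_nat i) * (\<Prod>i<s. of_nat y + of_nat u + 1 + of_nat i) :: complex)"
    proof -
      have "of_nat ((y + u) choose y) = (fact (y + u) / (fact y * fact u) :: complex)"
        by (subst binomial_fact) auto
      then show ?thesis
        unfolding bin fact_eq_rising_prod[of "y + u" s]
        using fact_eq_falling_prod[OF True, where 'a = complex] falling_nz
        by (simp add: field_simps)
    qed
    moreover have "complex_of_real (q powi int (y - c)) = of_real q ^ y / of_real q ^ c"
      unfolding power_int_of_nat of_real_power using True q by (simp add: power_diff)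
    ultimately show ?thesis
      unfolding x weight_def top heaviside_def
      by (simp add: p_def K_def poly_prod algebra_simps)
  qed
  then show ?thesis using deg by (auto simp: u_def)
qed

text \<open>A difference of order \<open>j\<close> at shift \<open>s\<close> only involves the weight at the shifts \<open>s, \<dots>, s + j\<close>, all
  less than \<open>n\<close>. The shift is arbitrary because one difference needs the induction hypothesis at both
  \<open>s\<close> and \<open>s + 1\<close>.\<close>

lemma funpow_fdiff_weight_eq_poly:
  assumes q: "q \<noteq> 0" and nm: "n \<le> m" and s: "j + s < n"
  shows "\<exists>p. degree p < n \<and> (\<forall>y. (fdiff ^^ j) (weight q m) (int y - int n + 1 + int s) =
     of_real (real ((y + (m - n)) choose y) * q ^ y) * poly p (of_nat y))"
  using s
proof (induction j arbitrary: s)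
  case 0
  then show ?case using weight_shift_eq_poly[OF q nm] by simp
next
  case (Suc j)
  obtain p where p: "degree p < n" "\<And>y. (fdiff ^^ j) (weight q m) (int y - int n + 1 + int s) =
     of_real (real ((y + (m - n)) choose y) * q ^ y) * poly p (of_nat y)"
    using Suc.IH[of s] Suc.prems by auto
  obtain p' where p': "degree p' < n" "\<And>y. (fdiff ^^ j) (weight q m) (int y - int n + 1 + int (Suc s)) =
     of_real (real ((y + (m - n)) choose y) * q ^ y) * poly p' (of_nat y)"
    using Suc.IH[of "Suc s"] Suc.prems by auto
  have "(fdiff ^^ Suc j) (weight q m) (int y - int n + 1 + int s) =
     of_real (real ((y + (m - n)) choose y) * q ^ y) * poly (p' - p) (of_nat y)" for y
    using p(2)[of y] p'(2)[of y] by (simp add: fdiff_def algebra_simps)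
  moreover have "degree (p' - p) < n"
    using p'(1) p(1) by (rule degree_diff_less)
  ultimately show ?case by blast
qed

lemma gbinomial_eq_poly:
  "\<exists>a :: complex poly. degree a \<le> i \<and> (\<forall>x. poly a x = (c - x) gchoose i)"
proof -
  define a where "a = Polynomial.smult (1 / fact i) (\<Prod>k\<in>{0..<i}. [:c - of_nat k, -1:])"
  have "degree (\<Prod>k\<in>{0..<i}. [:c - of_nat k, -1:]) \<le> i"
    by (rule order.trans[OF degree_prod_sum_le]) auto
  then have "degree a \<le> i"
    unfolding a_def by (rule order.trans[OF degree_smult_le])
  moreover have "poly a x = (c - x) gchoose i" for x
    by (simp add: a_def poly_prod gbinomial_prod_rev algebra_simps)
  ultimately show ?thesis by blast
qed

section \<open>Summation by parts over all natural numbers\<close>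

text \<open>As a polynomial in \<open>y\<close>, \<open>(c - y) gchoose i\<close> does not vanish beyond \<open>c\<close>, so it is not cut off as in
  a truncated sum. Shifting \<open>y\<close> by one moves the difference from \<open>g\<close> to this polynomial, where Pascal's
  rule lowers \<open>i\<close>; the boundary term is a multiple of \<open>g 0\<close>.\<close>

lemma gbinomial_sum_by_parts:
  fixes g :: "nat \<Rightarrow> complex"
  assumes g0: "g 0 = 0" and summ: "\<And>i. summable (\<lambda>y. ((c - of_nat y) gchoose i) * g y)"
  shows "(\<Sum>y. ((c - of_nat y) gchoose i) * (g (Suc y) - g y)) =
    (if i = 0 then 0 else (\<Sum>y. ((c - of_nat y) gchoose (i - 1)) * g y))"
proof -
  let ?b = "\<lambda>i y. (c - of_nat y) gchoose i"
  let ?e = "\<lambda>i y. (c - of_nat y + 1) gchoose i"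
  have e: "?e i y = ?b i y + (if i = 0 then 0 else ?b (i - 1) y)" for i y
    by (cases i) (auto simp: gbinomial_Suc_Suc)
  have se: "summable (\<lambda>y. ?e i y * g y)"
    unfolding e using summable_add[OF summ[of i] summ[of "i - 1"]] summ[of i]
    by (cases i) (auto simp: distrib_right)
  have shift: "(\<lambda>y. ?b i y * g (Suc y)) = (\<lambda>y. ?e i (Suc y) * g (Suc y))"
    by (simp add: algebra_simps)
  have "summable (\<lambda>y. ?b i y * g (Suc y))"
    unfolding shift using se by (subst summable_Suc_iff)
  then have "(\<Sum>y. ?b i y * (g (Suc y) - g y)) = (\<Sum>y. ?b i y * g (Suc y)) - (\<Sum>y. ?b i y * g y)"
    by (simp add: right_diff_distrib suminf_diff summ)
  also have "(\<Sum>y. ?b i y * g (Suc y)) = (\<Sum>y. ?e i y * g y)"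
    unfolding shift using suminf_split_head[OF se] g0 by simp
  also have "\<dots> - (\<Sum>y. ?b i y * g y) = (\<Sum>y. ?e i y * g y - ?b i y * g y)"
    by (rule suminf_diff[OF se summ])
  also have "\<dots> = (if i = 0 then 0 else (\<Sum>y. ?b (i - 1) y * g y))"
    unfolding e by (simp add: algebra_simps)
  finally show ?thesis .
qed

lemma weight_sums_1:
  assumes "0 < q" "q < 1" "1 \<le> m"
  shows "(\<lambda>y. weight q m (int y)) sums 1"
proof -
  have "(\<lambda>y. (1 - q) ^ m * (real ((y + (m - 1)) choose y) * q ^ y)) sums ((1 - q) ^ m * (1 / (1 - q) ^ Suc (m - 1)))"
    by (intro sums_mult negative_binomial_sums) (use assms in auto)
  then have "(\<lambda>y. (1 - q) ^ m * (real ((y + (m - 1)) choose y) * q ^ y)) sums 1"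
    using assms by (simp del: power_Suc)
  then have "(\<lambda>y. complex_of_real ((1 - q) ^ m * (real ((y + (m - 1)) choose y) * q ^ y))) sums of_real 1"
    by (rule sums_of_real)
  moreover have "nat (int y + int m - 1) = y + (m - 1)" for y using assms by simp
  ultimately show ?thesis
    by (simp add: weight_def heaviside_def mult.assoc)
qed

text \<open>Each summation by parts trades \<open>(i, j)\<close> for \<open>(i - 1, j - 1)\<close>. For \<open>i < j\<close> the
  degree of the polynomial runs out first and the sum is zero; for \<open>i = j\<close> what remains is the total mass of the weight.\<close>

lemma gbinomial_funpow_fdiff_weight_sum:
  assumes q: "0 < q" "q < 1" and nm: "n \<le> m" and j: "j < n" and ij: "i \<le> j"
    and summ: "\<And>i j. j < n \<Longrightarrow>
      summable (\<lambda>y. ((c - of_nat y) gchoose i) * (fdiff ^^ j) (weight q m) (int y - int n + 1))"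
  shows "(\<Sum>y. ((c - of_nat y) gchoose i) * (fdiff ^^ j) (weight q m) (int y - int n + 1))
    = (if i = j then 1 else 0)"
  using j ij
proof (induction j arbitrary: i)
  case 0
  have "(\<lambda>y. weight q m (int (y + (n - 1)) - int n + 1)) sums 1"
    using weight_sums_1[OF q, of m] 0 nm by simp
  then have "(\<lambda>y. weight q m (int y - int n + 1)) sums 1"
    by (subst (asm) sums_zero_iff_shift) (auto intro!: weight_eq_zero)
  then show ?case using 0 by (simp add: sums_iff)
next
  case (Suc j)
  let ?g = "\<lambda>y. (fdiff ^^ j) (weight q m) (int y - int n + 1)"
  (* No boundary term: (fdiff ^^ j) w starts at -j, and 1 - n < -j since Suc j < n. *)
  have "?g 0 = 0"
    by (rule funpow_fdiff_eq_zero[of 0]) (use Suc.prems in \<open>auto intro: weight_eq_zero\<close>)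
  moreover have "(fdiff ^^ Suc j) (weight q m) (int y - int n + 1) = ?g (Suc y) - ?g y" for y
    by (simp add: fdiff_def algebra_simps)
  ultimately show ?case
    using gbinomial_sum_by_parts[of ?g c i] summ Suc by (cases i) auto
qed

section \<open>The Meixner determinant formula\<close>

theorem proposition2p4:
  fixes q :: real and \<eta> m n :: nat
  assumes "0 < q" and "q < 1" and "1 \<le> n" and "n \<le> m"
  shows "Determinant.det (Matrix.mat n n
           (\<lambda>(i, j). fdiff_pow (int j - int i - 1) (weight q m) (int \<eta> + 1))) =
         complex_of_real (1 / meixner_Z q m n *
           (\<Sum>x\<in>{..<n} \<rightarrow>\<^sub>E {0..\<eta> + n - 1}. meixner_density q m n x))"
proof -
  define L where "L = \<eta> + n - 1"
  define w where "w y = real ((y + (m - n)) choose y) * q ^ y" for y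
  define D where "D j y = (fdiff ^^ j) (weight q m) (int y - int n + 1)" for j y
  define b where "b i y = ((of_nat L - of_nat y :: complex) gchoose i)" for i y
  have mom: "(\<lambda>y. real y ^ k * w y) abs_summable_on S" for k S
    unfolding w_def by (rule moments_summable) (use assms in auto)
  have density: "meixner_density q m n x = (vandermonde n (\<lambda>i. real (x i)))\<^sup>2 * (\<Prod>j<n. w (x j))" for x
    using assms by (simp add: meixner_density_def w_def)
  have "\<exists>p. j < n \<longrightarrow> degree p < n \<and> (\<forall>y. D j y = of_real (w y) * poly p (of_nat y))" for j
    using funpow_fdiff_weight_eq_poly[of q n m j 0] assms by (auto simp: D_def w_def)
  then obtain p where p: "\<And>j. j < n \<Longrightarrow> degree (p j) < n"
      "\<And>j y. j < n \<Longrightarrow> D j y = of_real (w y) * poly (p j) (of_nat y)"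
    by metis
  obtain a where a: "\<And>i. degree (a i) \<le> i" "\<And>i x. poly (a i) x = ((of_nat L - x :: complex) gchoose i)"
    using gbinomial_eq_poly[of _ "of_nat L"] by metis
  have summ: "(\<lambda>y. b i y * D j y) summable_on S" if "j < n" for i j S
    using has_sum_imp_summable[OF has_sum_poly_moments[OF mom le_imp_less_Suc[OF a(1)] p(1)[OF that]]] that
    by (simp add: b_def a p)
  define C where "C = Determinant.det (Matrix.mat n n (\<lambda>(i, k). coeff (a i) k)) *
    Determinant.det (Matrix.mat n n (\<lambda>(l, j). coeff (p j) l)) / fact n"
  have detS: "Determinant.det (Matrix.mat n n (\<lambda>(i, j). \<Sum>\<^sub>\<infinity>y\<in>S. b i y * D j y))
      = C * of_real (\<Sum>\<^sub>\<infinity>x\<in>{..<n} \<rightarrow>\<^sub>E S. meixner_density q m n x)" for S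
  proof -
    have "Matrix.mat n n (\<lambda>(i, j). \<Sum>\<^sub>\<infinity>y\<in>S. b i y * D j y)
      = Matrix.mat n n (\<lambda>(i, j). \<Sum>\<^sub>\<infinity>y\<in>S. poly (a i) (of_nat y) * (of_real (w y) * poly (p j) (of_nat y)))"
      by (rule cong_mat) (auto simp: a p b_def)
    then show ?thesis
      unfolding C_def density
      by (subst det_poly_sums[OF mom, symmetric]) (use p le_less_trans[OF a(1)] in auto)
  qed
  have full: "(\<Sum>\<^sub>\<infinity>y. b i y * D j y) = (if i = j then 1 else 0)" if "i \<le> j" "j < n" for i j
  proof -
    have "summable (\<lambda>y. ((of_nat L - of_nat y) gchoose i) * (fdiff ^^ j) (weight q m) (int y - int n + 1))"
      if "j < n" for i j
      using summable_on_imp_summable[OF summ[OF that]] by (simp add: b_def D_def)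
    from gbinomial_funpow_fdiff_weight_sum[OF assms(1,2,4) \<open>j < n\<close> \<open>i \<le> j\<close> this]
    have "(\<Sum>y. b i y * D j y) = (if i = j then 1 else 0)"
      by (simp add: b_def D_def)
    then show ?thesis
      using has_sum_imp_sums[OF has_sum_infsum[OF summ[OF \<open>j < n\<close>]]] by (simp add: sums_iff)
  qed
  (* S = UNIV determines C, and shows that the normalization is nonzero. *)
  have "C * of_real (meixner_Z q m n) = Determinant.det (Matrix.mat n n (\<lambda>(i, j). \<Sum>\<^sub>\<infinity>y. b i y * D j y))"
    unfolding detS meixner_Z_def ..
  also have "\<dots> = 1"
    by (subst det_lower_triangular[where n = n]) (auto simp: full prod_list_diag_prod)
  finally have CZ: "C * of_real (meixner_Z q m n) = 1" .
  have "Matrix.mat n n (\<lambda>(i, j). fdiff_pow (int j - int i - 1) (weight q m) (int \<eta> + 1))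
      = Matrix.mat n n (\<lambda>(i, j). \<Sum>\<^sub>\<infinity>y\<in>{0..L}. b i y * D j y)"
    by (rule cong_mat) (auto simp: b_def D_def L_def fdiff_pow_eq_gbinomial_sum[OF weight_eq_zero])
  then have "Determinant.det (Matrix.mat n n (\<lambda>(i, j). fdiff_pow (int j - int i - 1) (weight q m) (int \<eta> + 1)))
      = C * of_real (\<Sum>\<^sub>\<infinity>x\<in>{..<n} \<rightarrow>\<^sub>E {0..L}. meixner_density q m n x)"
    by (simp only: detS)
  also have "(\<Sum>\<^sub>\<infinity>x\<in>{..<n} \<rightarrow>\<^sub>E {0..L}. meixner_density q m n x)
      = (\<Sum>x\<in>{..<n} \<rightarrow>\<^sub>E {0..L}. meixner_density q m n x)"
    by (rule infsum_finite) (simp add: finite_PiE)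
  also have "C = of_real (1 / meixner_Z q m n)"
    using CZ by (cases "meixner_Z q m n = 0") (auto simp: field_simps)
  finally show ?thesis by (simp add: L_def)
qed

end
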